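(* (Löb induction.) In the internal logic of $\mathcal{S}$: $\forall\,\kappa:\mathbb{K}.\ \forall\,\phi:\Omega.\ (\triangleright^{\kappa}\phi\Rightarrow\phi)\Rightarrow\phi$.
   Context: Let $\mathbb{F}^+$ be the category whose objects are $\bullet^n$ for $n>0$ (free category with strictly associative binary products on one object); a morphism $\bullet^n\to\bullet^m$ is equivalently a function $\{0,\dots,m-1\}\to\{0,\dots,n-1\}$. Let $\mathcal{N}=\mathrm{Hom}_{\mathbb{F}^+}(-,\bullet^1)$. For $U\in\mathbb{F}^+$ let $\mathrm{CLK}[U]=\omega^{\mathcal{N}(U)}$ ordered pointwise, with $\mathrm{CLK}[f](\partial_V)=(\kappa\mapsto\partial_V(f^*\kappa))$ for $f:V\to U$. The category $\mathbb{CLK}$ has objects $\mathbf{U}=(U,\partial_U)$ and morphisms $f:(V,\partial_V)\to(U,\partial_U)$ the $\mathbb{F}^+$-maps $f:V\to U$ with $\mathrm{CLK}[f](\partial_V)\le\partial_U$. $\mathcal{S}$ is the presheaf topos on $\mathbb{CLK}$, with clock object $\mathbb{K}(U,\partial_U)=\mathcal{N}(U)$ and subobject classifier $\Omega$. Write $\mathbf{U}[\kappa\mapsto n]$ for $(U,\partial_U[\kappa\mapsto n])$ and $[\kappa\mathrel{+}=1]:\mathbf{U}\to\mathbf{U}[\kappa\mapsto\partial_U(\kappa)+1]$ for the morphism with identity underlying map. The later modality is defined by forcing: $\mathbf{U}\Vdash\triangleright^{\kappa}\phi(\alpha)$ iff $\partial_U(\kappa)=0$, or $\partial_U(\kappa)=n+1$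 and $\mathbf{U}[\kappa\mapsto n]\Vdash\phi([\kappa\mathrel{+}=1]^*\alpha)$. Other connectives are interpreted by standard Kripke–Joyal semantics. *)

theory Defs
  imports "HOL-Library.FuncSet"
begin

section \<open>Categories and presheaves\<close>

text \<open>Composition \<open>Comp C f g\<close> is \<open>f\<close> after \<open>g\<close>.\<close>

record ('o, 'm) cat =
  Obj :: "'o set"
  Arr :: "'m set"
  Dom :: "'m \<Rightarrow> 'o"
  Cod :: "'m \<Rightarrow> 'o"
  Id :: "'o \<Rightarrow> 'm"
  Comp :: "'m \<Rightarrow> 'm \<Rightarrow> 'm"

definition hom :: "('o, 'm) cat \<Rightarrow> 'o \<Rightarrow> 'o \<Rightarrow> 'm set" where
  "hom C V U = {f \<in> Arr C. Dom C f = V \<and> Cod C f = U}"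

locale category =
  fixes C :: "('o, 'm) cat"
  assumes Dom_Obj: "f \<in> Arr C \<Longrightarrow> Dom C f \<in> Obj C"
    and Cod_Obj: "f \<in> Arr C \<Longrightarrow> Cod C f \<in> Obj C"
    and Id_hom: "U \<in> Obj C \<Longrightarrow> Id C U \<in> hom C U U"
    and Comp_hom: "f \<in> hom C V U \<Longrightarrow> g \<in> hom C W V \<Longrightarrow> Comp C f g \<in> hom C W U"
    and Comp_Id: "f \<in> hom C V U \<Longrightarrow> Comp C f (Id C V) = f"
    and Id_Comp: "f \<in> hom C V U \<Longrightarrow> Comp C (Id C U) f = f"
    and Comp_assoc: "f \<in> hom C V U \<Longrightarrow> g \<in> hom C W V \<Longrightarrow> h \<in> hom C X W
      \<Longrightarrow> Comp C (Comp C f g) h = Comp C f (Comp C g h)"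

record ('o, 'm, 'x) psh =
  sect :: "'o \<Rightarrow> 'x set"
  restr :: "'m \<Rightarrow> 'x \<Rightarrow> 'x"

locale presheaf = category C for C :: "('o, 'm) cat" +
  fixes X :: "('o, 'm, 'x) psh"
  assumes restr_sect: "f \<in> hom C V U \<Longrightarrow> x \<in> sect X U \<Longrightarrow> restr X f x \<in> sect X V"
    and restr_Id: "U \<in> Obj C \<Longrightarrow> x \<in> sect X U \<Longrightarrow> restr X (Id C U) x = x"
    and restr_Comp: "f \<in> hom C V U \<Longrightarrow> g \<in> hom C W V \<Longrightarrow> x \<in> sect X U
      \<Longrightarrow> restr X (Comp C f g) x = restr X g (restr X f x)"

definition terminal_psh :: "('o, 'm, unit) psh" where
  "terminal_psh = \<lparr>sect = (\<lambda>U. {()}), restr = (\<lambda>f x. ())\<rparr>"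

definition prod_psh :: "('o, 'm, 'x) psh \<Rightarrow> ('o, 'm, 'y) psh \<Rightarrow> ('o, 'm, 'x \<times> 'y) psh" where
  "prod_psh X Y = \<lparr>sect = (\<lambda>U. sect X U \<times> sect Y U),
    restr = (\<lambda>f (x, y). (restr X f x, restr Y f y))\<rparr>"

definition max_sieve :: "('o, 'm) cat \<Rightarrow> 'o \<Rightarrow> 'm set" where
  "max_sieve C U = {f \<in> Arr C. Cod C f = U}"

definition sieves :: "('o, 'm) cat \<Rightarrow> 'o \<Rightarrow> 'm set set" where
  "sieves C U = {S. S \<subseteq> max_sieve C U \<and>
    (\<forall>f\<in>S. \<forall>g\<in>Arr C. Cod C g = Dom C f \<longrightarrow> Comp C f g \<in> S)}"

definition Omega :: "('o, 'm) cat \<Rightarrow> ('o, 'm, 'm set) psh" where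
  "Omega C = \<lparr>sect = sieves C,
    restr = (\<lambda>f S. {g \<in> max_sieve C (Dom C f). Comp C f g \<in> S})\<rparr>"


section \<open>Kripke--Joyal semantics\<close>

text \<open>A formula in context \<open>\<Gamma>\<close> (a presheaf) is represented by its forcing relation:
  \<open>\<phi> U \<alpha>\<close> means that \<open>U\<close> forces \<open>\<phi>(\<alpha>)\<close>, for \<open>\<alpha>\<close> in \<open>sect \<Gamma> U\<close>.
  A term in context \<open>\<Gamma>\<close> is represented by its components.\<close>

type_synonym ('o, 'g) formula = "'o \<Rightarrow> 'g \<Rightarrow> bool"
type_synonym ('o, 'g, 'x) trm = "'o \<Rightarrow> 'g \<Rightarrow> 'x"

definition kj_holds :: "('o, 'm) cat \<Rightarrow> ('o, 'g, 'm set) trm \<Rightarrow> ('o, 'g) formula" where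
  "kj_holds C t U \<alpha> \<longleftrightarrow> t U \<alpha> = max_sieve C U"

definition kj_imp ::
  "('o, 'm) cat \<Rightarrow> ('o, 'm, 'g) psh \<Rightarrow> ('o, 'g) formula \<Rightarrow> ('o, 'g) formula \<Rightarrow> ('o, 'g) formula" where
  "kj_imp C \<Gamma> \<phi> \<psi> U \<alpha> \<longleftrightarrow>
    (\<forall>V\<in>Obj C. \<forall>f\<in>hom C V U. \<phi> V (restr \<Gamma> f \<alpha>) \<longrightarrow> \<psi> V (restr \<Gamma> f \<alpha>))"

definition kj_all ::
  "('o, 'm) cat \<Rightarrow> ('o, 'm, 'g) psh \<Rightarrow> ('o, 'm, 'x) psh \<Rightarrow> ('o, 'g \<times> 'x) formula \<Rightarrow> ('o, 'g) formula" where
  "kj_all C \<Gamma> X \<phi> U \<alpha> \<longleftrightarrow>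
    (\<forall>V\<in>Obj C. \<forall>f\<in>hom C V U. \<forall>x\<in>sect X V. \<phi> V (restr \<Gamma> f \<alpha>, x))"

definition kj_valid :: "('o, 'm) cat \<Rightarrow> ('o, unit) formula \<Rightarrow> bool" where
  "kj_valid C \<phi> \<longleftrightarrow> (\<forall>U\<in>Obj C. \<phi> U ())"


section \<open>The category of clock contexts\<close>

datatype ('o, 'f) arrow = Arrow (src: 'o) (und: 'f) (tgt: 'o)

type_synonym farr = "(nat, nat \<Rightarrow> nat) arrow"

text \<open>The object \<open>n > 0\<close> stands for the \<open>n\<close>-fold power of the generating object; an arrow from
  \<open>n\<close> to \<open>m\<close> is a function from \<open>{..<m}\<close> to \<open>{..<n}\<close>, so composition is reversed.\<close>

definition Fplus :: "(nat, farr) cat" where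
  "Fplus = \<lparr>
    Obj = {n. 0 < n},
    Arr = {a. 0 < src a \<and> 0 < tgt a \<and> und a \<in> {..<tgt a} \<rightarrow>\<^sub>E {..<src a}},
    Dom = src,
    Cod = tgt,
    Id = (\<lambda>n. Arrow n (\<lambda>i\<in>{..<n}. i) n),
    Comp = (\<lambda>f g. Arrow (src g) (\<lambda>i\<in>{..<tgt f}. und g (und f i)) (tgt f))\<rparr>"

definition NN :: "nat \<Rightarrow> farr set" where
  "NN U = hom Fplus U 1"

definition CLK :: "nat \<Rightarrow> (farr \<Rightarrow> nat) set" where
  "CLK U = NN U \<rightarrow>\<^sub>E UNIV"

text \<open>The action on an arrow \<open>f\<close> from \<open>V\<close> to \<open>U\<close>; the pullback of a clock \<open>\<kappa>\<close> along \<open>f\<close>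
  is precomposition.\<close>

definition CLK_map :: "farr \<Rightarrow> (farr \<Rightarrow> nat) \<Rightarrow> (farr \<Rightarrow> nat)" where
  "CLK_map f d = (\<lambda>\<kappa>\<in>NN (Cod Fplus f). d (Comp Fplus \<kappa> f))"

type_synonym stage = "nat \<times> (farr \<Rightarrow> nat)"
type_synonym carr = "(stage, farr) arrow"

definition CLKcat :: "(stage, carr) cat" where
  "CLKcat = \<lparr>
    Obj = {(U, d). U \<in> Obj Fplus \<and> d \<in> CLK U},
    Arr = {Arrow (V, dV) f (U, dU) | V dV f U dU.
      V \<in> Obj Fplus \<and> dV \<in> CLK V \<and> U \<in> Obj Fplus \<and> dU \<in> CLK U \<and>
      f \<in> hom Fplus V U \<and> (\<forall>\<kappa>\<in>NN U. CLK_map f dV \<kappa> \<le> dU \<kappa>)},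
    Dom = src,
    Cod = tgt,
    Id = (\<lambda>U. Arrow U (Id Fplus (fst U)) U),
    Comp = (\<lambda>f g. Arrow (src g) (Comp Fplus (und f) (und g)) (tgt f))\<rparr>"

definition KK :: "(stage, carr, farr) psh" where
  "KK = \<lparr>sect = (\<lambda>U. NN (fst U)), restr = (\<lambda>f \<kappa>. Comp Fplus \<kappa> (und f))\<rparr>"

definition set_clock :: "stage \<Rightarrow> farr \<Rightarrow> nat \<Rightarrow> stage" where
  "set_clock U \<kappa> n = (fst U, (snd U)(\<kappa> := n))"

definition tick :: "stage \<Rightarrow> farr \<Rightarrow> carr" where
  "tick U \<kappa> = Arrow U (Id Fplus (fst U)) (set_clock U \<kappa> (snd U \<kappa> + 1))"

text \<open>If the clock \<open>\<kappa>\<close> has value \<open>n + 1\<close> at \<open>U\<close>, then \<open>tick (set_clock U \<kappa> n) \<kappa>\<close> has codomain \<open>U\<close>.\<close>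

definition later ::
  "(stage, carr, 'g) psh \<Rightarrow> (stage, 'g, farr) trm \<Rightarrow> (stage, 'g) formula \<Rightarrow> (stage, 'g) formula" where
  "later \<Gamma> k \<phi> U \<alpha> \<longleftrightarrow> (let \<kappa> = k U \<alpha> in
    snd U \<kappa> = 0 \<or>
    (\<exists>n. snd U \<kappa> = n + 1 \<and>
      \<phi> (set_clock U \<kappa> n) (restr \<Gamma> (tick (set_clock U \<kappa> n) \<kappa>) \<alpha>)))"


section \<open>Well-definedness\<close>

lemma category_Fplus: "category Fplus"
proof
  fix f V U assume "f \<in> hom Fplus V U"
  then show "Comp Fplus f (Id Fplus V) = f" "Comp Fplus (Id Fplus U) f = f"
    by (cases f; fastforce simp: Fplus_def hom_def PiE_iff extensional_def restrict_def)+
next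
  fix f g h V U W X
  assume "f \<in> hom Fplus V U" "g \<in> hom Fplus W V" "h \<in> hom Fplus X W"
  then show "Comp Fplus (Comp Fplus f g) h = Comp Fplus f (Comp Fplus g h)"
    by (fastforce simp: Fplus_def hom_def PiE_iff restrict_def)
qed (auto simp: Fplus_def hom_def PiE_iff)

interpretation Fplus: category Fplus by (rule category_Fplus)

lemma CLKcat_simps [simp]:
  "Obj CLKcat = {(U, d). U \<in> Obj Fplus \<and> d \<in> CLK U}"
  "Dom CLKcat = src" "Cod CLKcat = tgt"
  "Id CLKcat U = Arrow U (Id Fplus (fst U)) U"
  "Comp CLKcat f g = Arrow (src g) (Comp Fplus (und f) (und g)) (tgt f)"
  by (simp_all add: CLKcat_def)

lemma CLK_map_apply: "f \<in> hom Fplus V U \<Longrightarrow> \<kappa> \<in> NN U \<Longrightarrow> CLK_map f d \<kappa> = d (Comp Fplus \<kappa> f)"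
  by (simp add: CLK_map_def hom_def)

lemma hom_CLKcat:
  "a \<in> hom CLKcat V U \<longleftrightarrow> V \<in> Obj CLKcat \<and> U \<in> Obj CLKcat \<and> src a = V \<and> tgt a = U \<and>
    und a \<in> hom Fplus (fst V) (fst U) \<and>
    (\<forall>\<kappa>\<in>NN (fst U). snd V (Comp Fplus \<kappa> (und a)) \<le> snd U \<kappa>)"
  by (cases a; cases V; cases U)
     (auto simp: CLKcat_def hom_def[of "\<lparr>Obj = _, Arr = _, Dom = _, Cod = _, Id = _, Comp = _\<rparr>"]
       CLK_map_apply)

lemma NN_pullback: "f \<in> hom Fplus V U \<Longrightarrow> \<kappa> \<in> NN U \<Longrightarrow> Comp Fplus \<kappa> f \<in> NN V"
  unfolding NN_def by (rule Fplus.Comp_hom)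

lemma Arr_CLKcatD: "f \<in> Arr CLKcat \<Longrightarrow> f \<in> hom CLKcat (src f) (tgt f)"
  by (simp add: hom_def)

lemma category_CLKcat: "category CLKcat"
proof
  fix f V U assume "f \<in> hom CLKcat V U"
  then show "Comp CLKcat f (Id CLKcat V) = f" "Comp CLKcat (Id CLKcat U) f = f"
    by (cases f; auto simp: hom_CLKcat Fplus.Comp_Id Fplus.Id_Comp)+
next
  fix f g V U W assume f: "f \<in> hom CLKcat V U" and g: "g \<in> hom CLKcat W V"
  have "snd W (Comp Fplus \<kappa> (Comp Fplus (und f) (und g))) \<le> snd U \<kappa>" if k: "\<kappa> \<in> NN (fst U)" for \<kappa>
  proof -
    have "snd W (Comp Fplus (Comp Fplus \<kappa> (und f)) (und g)) \<le> snd V (Comp Fplus \<kappa> (und f))"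
      using f g k by (auto simp: hom_CLKcat dest: NN_pullback)
    also have "\<dots> \<le> snd U \<kappa>" using f k by (auto simp: hom_CLKcat)
    finally show ?thesis
      using f g k Fplus.Comp_assoc[of \<kappa> "fst U" 1 "und f" "fst V" "und g" "fst W"]
      by (simp add: hom_CLKcat NN_def)
  qed
  then show "Comp CLKcat f g \<in> hom CLKcat W U"
    using f g by (auto simp: hom_CLKcat intro: Fplus.Comp_hom)
next
  fix U assume "U \<in> Obj CLKcat"
  then show "Id CLKcat U \<in> hom CLKcat U U"
    by (auto simp: hom_CLKcat NN_def Fplus.Id_hom Fplus.Comp_Id)
next
  fix f g h V U W X
  assume "f \<in> hom CLKcat V U" "g \<in> hom CLKcat W V" "h \<in> hom CLKcat X W"
  then show "Comp CLKcat (Comp CLKcat f g) h = Comp CLKcat f (Comp CLKcat g h)"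
    using Fplus.Comp_assoc[of "und f" "fst V" "fst U" "und g" "fst W" "und h" "fst X"]
    by (simp add: hom_CLKcat)
qed (use Arr_CLKcatD hom_CLKcat in auto)

interpretation CLKcat: category CLKcat by (rule category_CLKcat)

lemma presheaf_terminal: "category C \<Longrightarrow> presheaf C terminal_psh"
  by (simp add: presheaf_def presheaf_axioms_def terminal_psh_def)

lemma presheaf_prod:
  assumes "presheaf C X" "presheaf C Y"
  shows "presheaf C (prod_psh X Y)"
proof -
  interpret X: presheaf C X by fact
  interpret Y: presheaf C Y by fact
  show ?thesis
    by unfold_locales
       (auto simp: prod_psh_def X.restr_sect Y.restr_sect X.restr_Id Y.restr_Id
          X.restr_Comp Y.restr_Comp)
qed

lemma (in category) in_max_sieve: "g \<in> max_sieve C U \<longleftrightarrow> g \<in> hom C (Dom C g) U"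
  by (auto simp: max_sieve_def hom_def)

lemma (in category) sievesD:
  "S \<in> sieves C U \<Longrightarrow> f \<in> S \<Longrightarrow> f \<in> hom C (Dom C f) U"
  "S \<in> sieves C U \<Longrightarrow> f \<in> S \<Longrightarrow> g \<in> hom C W (Dom C f) \<Longrightarrow> Comp C f g \<in> S"
  by (auto simp: sieves_def max_sieve_def hom_def)

lemma (in category) homD: "f \<in> hom C V U \<Longrightarrow> f \<in> Arr C \<and> Dom C f = V \<and> Cod C f = U"
  by (simp add: hom_def)

lemma (in category) presheaf_Omega: "presheaf C (Omega C)"
proof
  fix f V U S assume f: "f \<in> hom C V U" and S: "S \<in> sect (Omega C) U"
  show "restr (Omega C) f S \<in> sect (Omega C) V"
  proof -
    have "Comp C g h \<in> max_sieve C V \<and> Comp C f (Comp C g h) \<in> S"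
      if g: "g \<in> max_sieve C V" and gS: "Comp C f g \<in> S"
        and h: "h \<in> Arr C" "Cod C h = Dom C g" for g h
    proof -
      have g': "g \<in> hom C (Dom C g) V" using g homD[OF f] by (simp add: in_max_sieve)
      have h': "h \<in> hom C (Dom C h) (Dom C g)" using h by (simp add: hom_def)
      have "Comp C g h \<in> hom C (Dom C (Comp C g h)) V"
        using Comp_hom[OF g' h'] by (simp add: hom_def)
      moreover have "Comp C (Comp C f g) h \<in> S"
        using S gS h' homD[OF Comp_hom[OF f g']] by (auto simp: Omega_def intro: sievesD(2))
      ultimately show ?thesis
        using Comp_assoc[OF f g' h'] by (simp add: in_max_sieve)
    qed
    then show ?thesis
      using homD[OF f] by (auto simp: Omega_def sieves_def)
  qed
next
  fix U S assume U: "U \<in> Obj C" and S: "S \<in> sect (Omega C) U"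
  then show "restr (Omega C) (Id C U) S = S"
    using homD[OF Id_hom[OF U]] Id_Comp
    by (fastforce simp: Omega_def in_max_sieve dest: sievesD(1))
next
  fix f g V U W S
  assume f: "f \<in> hom C V U" and g: "g \<in> hom C W V" and S: "S \<in> sect (Omega C) U"
  have "Comp C g h \<in> hom C (Dom C (Comp C g h)) V \<and>
      Comp C (Comp C f g) h = Comp C f (Comp C g h)"
    if "h \<in> hom C (Dom C h) W" for h
    using Comp_hom[OF g that] Comp_assoc[OF f g that] by (simp add: hom_def)
  then show "restr (Omega C) (Comp C f g) S = restr (Omega C) g (restr (Omega C) f S)"
    using homD[OF f] homD[OF g] homD[OF Comp_hom[OF f g]]
    by (auto simp: Omega_def in_max_sieve dest: homD)
qed

lemma presheaf_KK: "presheaf CLKcat KK"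
proof
  fix f V U \<kappa> assume "f \<in> hom CLKcat V U" "\<kappa> \<in> sect KK U"
  then show "restr KK f \<kappa> \<in> sect KK V"
    by (auto simp: KK_def hom_CLKcat intro: NN_pullback)
next
  fix U \<kappa> assume "U \<in> Obj CLKcat" "\<kappa> \<in> sect KK U"
  then show "restr KK (Id CLKcat U) \<kappa> = \<kappa>"
    by (auto simp: KK_def NN_def Fplus.Comp_Id)
next
  fix f g V U W \<kappa>
  assume "f \<in> hom CLKcat V U" "g \<in> hom CLKcat W V" "\<kappa> \<in> sect KK U"
  then show "restr KK (Comp CLKcat f g) \<kappa> = restr KK g (restr KK f \<kappa>)"
    using Fplus.Comp_assoc[of \<kappa> "fst U" 1 "und f" "fst V" "und g" "fst W"]
    by (simp add: KK_def NN_def hom_CLKcat)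
qed

lemma set_clock_Obj: "U \<in> Obj CLKcat \<Longrightarrow> \<kappa> \<in> NN (fst U) \<Longrightarrow> set_clock U \<kappa> n \<in> Obj CLKcat"
  by (auto simp: set_clock_def CLK_def PiE_iff extensional_def)

lemma tick_hom:
  assumes "U \<in> Obj CLKcat" "\<kappa> \<in> NN (fst U)"
  shows "tick U \<kappa> \<in> hom CLKcat U (set_clock U \<kappa> (snd U \<kappa> + 1))"
  using assms set_clock_Obj[OF assms] unfolding hom_CLKcat
  by (auto simp: tick_def set_clock_def Fplus.Id_hom Fplus.Comp_Id NN_def)

lemma set_clock_set_clock: "snd U \<kappa> = m \<Longrightarrow> set_clock (set_clock U \<kappa> n) \<kappa> m = U"
  by (cases U) (auto simp: set_clock_def)

text \<open>\<open>later\<close> preserves stability under restriction, i.e. it maps subpresheaves of the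
  context to subpresheaves of the context.\<close>

lemma later_mono:
  assumes G: "presheaf CLKcat \<Gamma>"
    and k: "\<And>U \<alpha>. U \<in> Obj CLKcat \<Longrightarrow> \<alpha> \<in> sect \<Gamma> U \<Longrightarrow> k U \<alpha> \<in> sect KK U"
    and nat: "\<And>V U f \<alpha>. f \<in> hom CLKcat V U \<Longrightarrow> \<alpha> \<in> sect \<Gamma> U
      \<Longrightarrow> k V (restr \<Gamma> f \<alpha>) = restr KK f (k U \<alpha>)"
    and \<phi>: "\<And>V U f \<alpha>. f \<in> hom CLKcat V U \<Longrightarrow> \<alpha> \<in> sect \<Gamma> U \<Longrightarrow> \<phi> U \<alpha> \<Longrightarrow> \<phi> V (restr \<Gamma> f \<alpha>)"
    and f: "f \<in> hom CLKcat V U" and \<alpha>: "\<alpha> \<in> sect \<Gamma> U" and L: "later \<Gamma> k \<phi> U \<alpha>"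
  shows "later \<Gamma> k \<phi> V (restr \<Gamma> f \<alpha>)"
proof -
  interpret G: presheaf CLKcat \<Gamma> by fact
  define \<kappa> where "\<kappa> = k U \<alpha>"
  define \<nu> where "\<nu> = Comp Fplus \<kappa> (und f)"
  have U: "U \<in> Obj CLKcat" and V: "V \<in> Obj CLKcat"
    and ff: "und f \<in> hom Fplus (fst V) (fst U)" and st: "src f = V" "tgt f = U"
    and le: "\<And>\<mu>. \<mu> \<in> NN (fst U) \<Longrightarrow> snd V (Comp Fplus \<mu> (und f)) \<le> snd U \<mu>"
    using f unfolding hom_CLKcat by auto
  have kk: "\<kappa> \<in> NN (fst U)" using k[OF U \<alpha>] by (simp add: KK_def \<kappa>_def)
  have lk: "k V (restr \<Gamma> f \<alpha>) = \<nu>" using nat[OF f \<alpha>] by (simp add: KK_def \<kappa>_def \<nu>_def)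
  have ll: "\<nu> \<in> NN (fst V)" unfolding \<nu>_def using NN_pullback[OF ff kk] .
  show ?thesis
  proof (cases "snd V \<nu>")
    case 0
    then show ?thesis by (simp add: later_def lk Let_def)
  next
    case (Suc m)
    then obtain n where n: "snd U \<kappa> = n + 1" and mn: "m \<le> n"
      using le[OF kk] by (cases "snd U \<kappa>") (auto simp: \<nu>_def)
    let ?U = "set_clock U \<kappa> n" and ?V = "set_clock V \<nu> m"
    let ?g = "Arrow ?V (und f) ?U"
    have tU: "tick ?U \<kappa> \<in> hom CLKcat ?U U"
      using tick_hom[OF set_clock_Obj[OF U kk], of \<kappa> n] kk n set_clock_set_clock[of U \<kappa> "n+1" n]
      by (simp add: set_clock_def)
    have tV: "tick ?V \<nu> \<in> hom CLKcat ?V V"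
      using tick_hom[OF set_clock_Obj[OF V ll], of \<nu> m] ll Suc set_clock_set_clock[of V \<nu> "m+1" m]
      by (simp add: set_clock_def)
    have g: "?g \<in> hom CLKcat ?V ?U"
    proof -
      have "snd ?V (Comp Fplus \<mu> (und f)) \<le> snd ?U \<mu>" if "\<mu> \<in> NN (fst U)" for \<mu>
        using le[OF that] mn Suc n by (auto simp: set_clock_def \<nu>_def)
      moreover have "fst ?U = fst U" "fst ?V = fst V" by (simp_all add: set_clock_def)
      ultimately show ?thesis
        using set_clock_Obj[OF U kk] set_clock_Obj[OF V ll] ff
        unfolding hom_CLKcat by auto
    qed
    have fUV: "tgt (tick ?U \<kappa>) = U" "src (tick ?V \<nu>) = ?V"
      using tU tV unfolding hom_CLKcat by auto
    have sq: "Comp CLKcat (tick ?U \<kappa>) ?g = Comp CLKcat f (tick ?V \<nu>)"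
      using ff st fUV by (simp add: Fplus.Id_Comp Fplus.Comp_Id)
        (simp add: tick_def set_clock_def Fplus.Id_Comp Fplus.Comp_Id)
    have "\<phi> ?U (restr \<Gamma> (tick ?U \<kappa>) \<alpha>)"
      using L n by (simp add: later_def Let_def flip: \<kappa>_def)
    then have "\<phi> ?V (restr \<Gamma> ?g (restr \<Gamma> (tick ?U \<kappa>) \<alpha>))"
      using \<phi>[OF g] G.restr_sect[OF tU \<alpha>] by blast
    then have "\<phi> ?V (restr \<Gamma> (tick ?V \<nu>) (restr \<Gamma> f \<alpha>))"
      using G.restr_Comp[OF tU g \<alpha>] G.restr_Comp[OF f tV \<alpha>] sq by simp
    then show ?thesis using Suc by (simp add: later_def lk Let_def)
  qed
qed

end

theory Submission
  imports Defs
begin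

text \<open>Every arrow into \<open>V\<close> composes with \<open>f\<close> to an arrow into
  \<open>U\<close>, so the implication at \<open>U\<close> already covers it. This carries the Loeb
  premise to the stage one tick earlier.\<close>

lemma kj_imp_restr:
  assumes "presheaf C \<Gamma>" and f: "f \<in> hom C V U" and \<alpha>: "\<alpha> \<in> sect \<Gamma> U"
    and imp: "kj_imp C \<Gamma> \<phi> \<psi> U \<alpha>"
  shows "kj_imp C \<Gamma> \<phi> \<psi> V (restr \<Gamma> f \<alpha>)"
proof -
  interpret presheaf C \<Gamma> by fact
  show ?thesis
    unfolding kj_imp_def
  proof (intro ballI impI)
    fix W g assume W: "W \<in> Obj C" and g: "g \<in> hom C W V"
      and "\<phi> W (restr \<Gamma> g (restr \<Gamma> f \<alpha>))"
    then show "\<psi> W (restr \<Gamma> g (restr \<Gamma> f \<alpha>))"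
      using imp Comp_hom[OF f g] by (simp add: kj_imp_def flip: restr_Comp[OF f g \<alpha>])
  qed
qed

text \<open>The identity is among the arrows over which a forced implication quantifies, and
  restriction along it is trivial.\<close>

lemma kj_imp_mp:
  assumes "presheaf C \<Gamma>" and U: "U \<in> Obj C" and \<alpha>: "\<alpha> \<in> sect \<Gamma> U"
    and imp: "kj_imp C \<Gamma> \<phi> \<psi> U \<alpha>" and \<phi>: "\<phi> U \<alpha>"
  shows "\<psi> U \<alpha>"
proof -
  interpret presheaf C \<Gamma> by fact
  show ?thesis
    using imp \<phi> U Id_hom[OF U] restr_Id[OF U \<alpha>] unfolding kj_imp_def by metis
qed

text \<open>Raising the lowered clock by one restores its original value, so the codomain of this
  tick is \<open>U\<close> itself.\<close>

lemma tick_set_clock_hom: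
  assumes U: "U \<in> Obj CLKcat" and \<kappa>: "\<kappa> \<in> NN (fst U)" and n: "snd U \<kappa> = n + 1"
  shows "tick (set_clock U \<kappa> n) \<kappa> \<in> hom CLKcat (set_clock U \<kappa> n) U"
  using tick_hom[OF set_clock_Obj[OF U \<kappa>], of \<kappa> n] \<kappa> n set_clock_set_clock[of U \<kappa> "n + 1" n]
  by (simp add: set_clock_def)

text \<open>Loeb induction at a single stage is ordinary induction on the time remaining on the clock:
  at time \<open>0\<close> the later modality holds vacuously, and at time \<open>n + 1\<close> the induction hypothesis
  applies after one tick, since the hypothesis is stable under restriction.\<close>

lemma loeb_induction:
  assumes \<Gamma>: "presheaf CLKcat \<Gamma>"
    and k: "\<And>U \<alpha>. U \<in> Obj CLKcat \<Longrightarrow> \<alpha> \<in> sect \<Gamma> U \<Longrightarrow> k U \<alpha> \<in> sect KK U"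
    and nat: "\<And>V U f \<alpha>. f \<in> hom CLKcat V U \<Longrightarrow> \<alpha> \<in> sect \<Gamma> U
      \<Longrightarrow> k V (restr \<Gamma> f \<alpha>) = restr KK f (k U \<alpha>)"
    and U: "U \<in> Obj CLKcat" and \<alpha>: "\<alpha> \<in> sect \<Gamma> U"
    and step: "kj_imp CLKcat \<Gamma> (later \<Gamma> k \<phi>) \<phi> U \<alpha>"
  shows "\<phi> U \<alpha>"
  using U \<alpha> step
\<comment> \<open>Stage and element are generalised because the induction hypothesis is used at a
  different stage, the domain of a tick.\<close>
proof (induction "snd U (k U \<alpha>)" arbitrary: U \<alpha>)
  case 0
  then have "later \<Gamma> k \<phi> U \<alpha>" by (simp add: later_def)
  then show ?case using kj_imp_mp[OF \<Gamma> 0(2-4)] by blast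
next
  case (Suc n)
  interpret presheaf CLKcat \<Gamma> by fact
  define \<kappa> where "\<kappa> = k U \<alpha>"
  let ?V = "set_clock U \<kappa> n" and ?t = "tick (set_clock U \<kappa> n) \<kappa>"
  have \<kappa>: "\<kappa> \<in> NN (fst U)" using k[OF Suc.prems(1,2)] by (simp add: KK_def \<kappa>_def)
  have n: "snd U \<kappa> = n + 1" using Suc.hyps(2) by (simp add: \<kappa>_def)
  have t: "?t \<in> hom CLKcat ?V U" using tick_set_clock_hom[OF Suc.prems(1) \<kappa> n] .
  \<comment> \<open>A tick has an identity underlying map, so naturality of \<open>k\<close> yields
    the same clock at \<open>?V\<close>. The clock that was lowered is therefore the one measured
    there, and it shows exactly \<open>n\<close>.\<close>
  have "k ?V (restr \<Gamma> ?t \<alpha>) = \<kappa>"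
    using nat[OF t Suc.prems(2)] \<kappa>
    by (simp add: KK_def tick_def set_clock_def NN_def Fplus.Comp_Id flip: \<kappa>_def)
  then have "n = snd ?V (k ?V (restr \<Gamma> ?t \<alpha>))" by (simp add: set_clock_def)
  then have "\<phi> ?V (restr \<Gamma> ?t \<alpha>)"
    using Suc.hyps(1) set_clock_Obj[OF Suc.prems(1) \<kappa>] restr_sect[OF t Suc.prems(2)]
      kj_imp_restr[OF \<Gamma> t Suc.prems(2,3)] by blast
  then have "later \<Gamma> k \<phi> U \<alpha>" using n by (simp add: later_def Let_def flip: \<kappa>_def)
  then show ?case using kj_imp_mp[OF \<Gamma> Suc.prems] by blast
qed

text \<open>Each quantifier extends the context by one component, so the bound variables become
  projections from nested pairs. A sieve, as a truth value, holds exactly when it is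
  maximal.\<close>

theorem mainTheorem8:
  defines "\<Gamma> \<equiv> prod_psh terminal_psh KK"
  defines "\<Delta> \<equiv> prod_psh \<Gamma> (Omega CLKcat)"
  defines "\<kappa> \<equiv> (\<lambda>U ((_, k), s). k)"
  defines "\<phi> \<equiv> kj_holds CLKcat (\<lambda>U ((_, k), s). s)"
  shows "kj_valid CLKcat
    (kj_all CLKcat terminal_psh KK
      (kj_all CLKcat \<Gamma> (Omega CLKcat)
        (kj_imp CLKcat \<Delta> (kj_imp CLKcat \<Delta> (later \<Delta> \<kappa> \<phi>) \<phi>) \<phi>)))"
proof -
  have G: "presheaf CLKcat \<Gamma>"
    unfolding \<Gamma>_def
    by (intro presheaf_prod presheaf_terminal presheaf_KK category_CLKcat)
  have D: "presheaf CLKcat \<Delta>"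
    unfolding \<Delta>_def by (intro presheaf_prod G CLKcat.presheaf_Omega)
  interpret G: presheaf CLKcat \<Gamma> by fact
  interpret D: presheaf CLKcat \<Delta> by fact
  have loeb: "\<phi> U \<alpha>"
    if "U \<in> Obj CLKcat" "\<alpha> \<in> sect \<Delta> U" "kj_imp CLKcat \<Delta> (later \<Delta> \<kappa> \<phi>) \<phi> U \<alpha>" for U \<alpha>
  \<comment> \<open>It remains to check that the projection to the clock is well typed and
    natural.\<close>
  proof (rule loeb_induction[OF D _ _ that])
    show "\<kappa> U \<alpha> \<in> sect KK U" if "\<alpha> \<in> sect \<Delta> U" for U \<alpha>
      using that by (auto simp: \<Delta>_def \<Gamma>_def \<kappa>_def prod_psh_def)
    show "\<kappa> V (restr \<Delta> f \<alpha>) = restr KK f (\<kappa> U \<alpha>)" for V U f \<alpha>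
      by (simp add: \<Delta>_def \<Gamma>_def \<kappa>_def prod_psh_def split: prod.split)
  qed
  show ?thesis
    unfolding kj_valid_def kj_all_def
  proof (intro ballI)
    fix U V f k W g s
    assume f: "f \<in> hom CLKcat V U" and k: "k \<in> sect KK V"
      and g: "g \<in> hom CLKcat W V" and s: "s \<in> sect (Omega CLKcat) W"
    have "(restr terminal_psh f (), k) \<in> sect \<Gamma> V"
      using k by (simp add: \<Gamma>_def prod_psh_def terminal_psh_def)
    then have "(restr \<Gamma> g (restr terminal_psh f (), k), s) \<in> sect \<Delta> W"
      using G.restr_sect[OF g] s by (simp add: \<Delta>_def prod_psh_def)
    then show "kj_imp CLKcat \<Delta> (kj_imp CLKcat \<Delta> (later \<Delta> \<kappa> \<phi>) \<phi>) \<phi> W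
        (restr \<Gamma> g (restr terminal_psh f (), k), s)"
      \<comment> \<open>The instantiation opens only the outer implication; the inner one stays
        folded to match the premise of \<open>loeb\<close>.\<close>
      unfolding kj_imp_def[of _ _ "kj_imp _ _ _ _"]
      using loeb D.restr_sect by blast
  qed
qed

end
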